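(* Let $1<p,q<\infty$ with $\frac1p+\frac1q=1$, and let $f,g\ge 0$ be measurable functions on $\mathbb{R}^n$ satisfying $$0<\int f^p\,dx<\infty,\qquad 0<\int g^q\,dx<\infty .$$ Define $F=f^p$, $G=g^q$ and, for $0\le\theta\le1$, $$Z(\theta)=\int F^{1-\theta}G^{\theta}\,dx,\qquad d\mu_\theta=\frac{F^{1-\theta}G^{\theta}}{Z(\theta)}\,dx .$$ Then the function $\theta\mapsto\log Z(\theta)$ is convex on $[0,1]$. Moreover, for $\theta\in[0,1]$, $$(\log Z)''(\theta)=\operatorname{Var}_{\mu_\theta}\!\left(\log G-\log F\right).$$
   Context: All integrals are with respect to Lebesgue measure $dx$. For $\theta=0$ the integrand $F^{1-\theta}G^\theta$ is read as $F$, and for $\theta=1$ as $G$, so that $Z(0)=\int f^p\,dx$ and $Z(1)=\int g^q\,dx$. $\operatorname{Var}_{\mu}(H)=\int H^2\,d\mu-\left(\int H\,d\mu\right)^2$ denotes the variance of a function $H$ under a probability measure $\mu$.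
   Formalization: The variance formula assumes Z(θ)>0 on [0,1]; if fg=0 a.e., Z vanishes on (0,1) and μ_θ is undefined. At θ=0,1 derivatives are one-sided and the identity is read in the extended reals, since both sides may be infinite. Convexity uses log 0=−∞. *)

theory Defs
  imports "HOL-Analysis.Analysis"
begin

(* Logarithm on [0, \<infinity>] with log 0 = - \<infinity> and log \<infinity> = \<infinity>
   (the library's real ln has the junk value ln 0 = 0). *)
definition elog :: "ennreal \<Rightarrow> ereal" where
  "elog a = (if a = 0 then - \<infinity> else if a = \<infinity> then \<infinity> else ereal (ln (enn2real a)))"

(* The integrand F^(1-\<theta>) G^\<theta>.  The end cases are separate because the library has
   0 powr 0 = 0, whereas the integrand is to be F at \<theta> = 0 and G at \<theta> = 1. *)
definition interp :: "('a \<Rightarrow> real) \<Rightarrow> ('a \<Rightarrow> real) \<Rightarrow> real \<Rightarrow> 'a \<Rightarrow> real" where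
  "interp F G \<theta> x =
     (if \<theta> = 0 then F x else if \<theta> = 1 then G x else F x powr (1 - \<theta>) * G x powr \<theta>)"

definition Z ::
  "('a::euclidean_space \<Rightarrow> real) \<Rightarrow> ('a \<Rightarrow> real) \<Rightarrow> real \<Rightarrow> ennreal" where
  "Z F G \<theta> = (\<integral>\<^sup>+x. ennreal (interp F G \<theta> x) \<partial>lebesgue)"

definition mu ::
  "('a::euclidean_space \<Rightarrow> real) \<Rightarrow> ('a \<Rightarrow> real) \<Rightarrow> real \<Rightarrow> 'a measure" where
  "mu F G \<theta> = density lebesgue (\<lambda>x. ennreal (interp F G \<theta> x) / Z F G \<theta>)"

(* log G - log F.  It is infinite where exactly one of F and G vanishes; such points can have
   positive mass only under mu F G 0 and mu F G 1.  Points where both vanish are null for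
   every mu F G \<theta>, so the value of (- \<infinity>) - (- \<infinity>) is irrelevant. *)
definition log_ratio :: "('a \<Rightarrow> real) \<Rightarrow> ('a \<Rightarrow> real) \<Rightarrow> 'a \<Rightarrow> ereal" where
  "log_ratio F G x = elog (ennreal (G x)) - elog (ennreal (F x))"

(* \<integral> H^2 - (\<integral> H)^2 for a probability measure, with value \<infinity> if the second moment is
   infinite.  If it is finite, then H is finite almost everywhere, so real_of_ereal only
   affects a null set. *)
definition ext_variance :: "'a measure \<Rightarrow> ('a \<Rightarrow> ereal) \<Rightarrow> ereal" where
  "ext_variance M H =
     (let m2 = (\<integral>\<^sup>+x. e2ennreal ((H x)\<^sup>2) \<partial>M)
      in if m2 = \<infinity> then \<infinity>
         else ereal (enn2real m2 - (\<integral>x. real_of_ereal (H x) \<partial>M)\<^sup>2))"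

(* Convexity for functions with values in [-\<infinity>, \<infinity>). *)
definition ext_convex_on :: "'a::real_vector set \<Rightarrow> ('a \<Rightarrow> ereal) \<Rightarrow> bool" where
  "ext_convex_on S \<phi> \<longleftrightarrow> convex S \<and>
     (\<forall>x\<in>S. \<forall>y\<in>S. \<forall>u\<ge>0. \<forall>v\<ge>0. u + v = 1 \<longrightarrow>
        \<phi> (u *\<^sub>R x + v *\<^sub>R y) \<le> ereal u * \<phi> x + ereal v * \<phi> y)"

(* Limit of difference quotients in the extended reals; relative to S = {0..1} it is
   one-sided at 0 and at 1, where the limit may be infinite. *)
definition has_ext_derivative ::
  "(real \<Rightarrow> ereal) \<Rightarrow> ereal \<Rightarrow> real \<Rightarrow> real set \<Rightarrow> bool" where
  "has_ext_derivative \<phi> d \<theta> S \<longleftrightarrow>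
     ((\<lambda>s. (\<phi> s - \<phi> \<theta>) / ereal (s - \<theta>)) \<longlongrightarrow> d) (at \<theta> within S)"

text \<open>For real values the extended notions are the usual ones.\<close>

lemma ext_convex_on_ereal: "ext_convex_on S (\<lambda>x. ereal (h x)) \<longleftrightarrow> convex_on S h"
  by (simp add: ext_convex_on_def convex_on_def)

lemma has_ext_derivative_ereal:
  "has_ext_derivative (\<lambda>t. ereal (h t)) (ereal d) \<theta> S \<longleftrightarrow>
     (h has_real_derivative d) (at \<theta> within S)"
proof -
  have "((\<lambda>s. (ereal (h s) - ereal (h \<theta>)) / ereal (s - \<theta>)) \<longlongrightarrow> ereal d) (at \<theta> within S)
     \<longleftrightarrow> ((\<lambda>s. ereal ((h s - h \<theta>) / (s - \<theta>))) \<longlongrightarrow> ereal d) (at \<theta> within S)"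
    by (rule tendsto_cong) (auto simp: eventually_at_filter)
  then show ?thesis
    by (simp add: has_ext_derivative_def has_field_derivative_iff)
qed

lemma ext_variance_ereal:
  fixes H :: "'a \<Rightarrow> real"
  assumes "integrable M (\<lambda>x. (H x)\<^sup>2)"
  shows "ext_variance M (\<lambda>x. ereal (H x)) = ereal ((\<integral>x. (H x)\<^sup>2 \<partial>M) - (\<integral>x. H x \<partial>M)\<^sup>2)"
  using nn_integral_eq_integral[OF assms]
  by (simp add: ext_variance_def Let_def ennreal.abs_eq[symmetric] enn2real_ennreal)

end

theory Submission
  imports Defs
begin

text \<open>
  On the set where both \<open>F\<close> and \<open>G\<close> are positive, put \<open>L = log G - log F\<close>; for \<open>0 < \<theta> < 1\<close> the
  function \<open>Z\<close> is the moment generating function \<open>\<integral> exp (\<theta> L) dN\<close> of \<open>L\<close> under the finite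
  measure \<open>N = F dx\<close> restricted to that set, and the variance formula comes from differentiating
  twice under the integral.  At \<open>\<theta> = 0\<close> there are three cases.  If \<open>G\<close> vanishes on a set of
  positive \<open>F dx\<close>-measure, \<open>log Z\<close> jumps down just to the right of 0, so the first derivative is
  \<open>-\<infinity>\<close>, the second is \<open>\<infinity>\<close>, and so is the variance.  If \<open>Z\<close> is continuous at 0 but \<open>L\<close> is not
  \<open>N\<close>-integrable, Fatou's lemma gives the same conclusion.  Otherwise the derivatives in the
  interior converge to those at 0 by dominated convergence, or by Fatou to \<open>\<infinity>\<close> if \<open>L\<^sup>2\<close> is not
  integrable, and the mean value theorem carries the limits over to the difference quotients.
  Exchanging \<open>F\<close> and \<open>G\<close> reduces \<open>\<theta> = 1\<close> to \<open>\<theta> = 0\<close>.  Convexity is Hoelder's inequality.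
\<close>

subsection \<open>Moments of an exponential family\<close>

text \<open>Limits at \<open>t\<close> are tested along sequences in \<open>T\<close> that avoid
  \<open>t\<close>, which reduces the claim to dominated convergence for sequences. Keeping
  \<open>g\<close> separate from \<open>f t\<close> makes it applicable to difference
  quotients.\<close>

lemma integral_tendsto_dominated:
  fixes f :: "real \<Rightarrow> 'a \<Rightarrow> real"
  assumes meas: "g \<in> borel_measurable M" "\<And>s. s \<in> T - {t} \<Longrightarrow> f s \<in> borel_measurable M"
    and w: "integrable M w"
    and lim: "\<And>x. x \<in> space M \<Longrightarrow> ((\<lambda>s. f s x) \<longlongrightarrow> g x) (at t within T)"
    and bound: "\<And>s x. s \<in> T - {t} \<Longrightarrow> x \<in> space M \<Longrightarrow> \<bar>f s x\<bar> \<le> w x"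
  shows "((\<lambda>s. \<integral>x. f s x \<partial>M) \<longlongrightarrow> (\<integral>x. g x \<partial>M)) (at t within T)"
  unfolding tendsto_at_iff_sequentially comp_def
proof (intro allI impI)
  fix X assume X: "\<forall>i. X i \<in> T - {t}" "X \<longlonglongrightarrow> t"
  show "(\<lambda>i. \<integral>x. f (X i) x \<partial>M) \<longlonglongrightarrow> (\<integral>x. g x \<partial>M)"
  proof (rule integral_dominated_convergence[where w = w])
    show "AE x in M. (\<lambda>i. f (X i) x) \<longlonglongrightarrow> g x"
      using lim X unfolding tendsto_at_iff_sequentially comp_def by (intro AE_I2) auto
  qed (use meas w bound X in auto)
qed

text \<open>By the mean value theorem the quotient is \<open>h'\<close> at some
  \<open>\<xi> s\<close> strictly between 0 and \<open>s\<close>, and \<open>\<xi> s\<close> is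
  squeezed to 0 from the right. The limit \<open>D\<close> is extended so that infinite one-sided
  derivatives are covered.\<close>

lemma quotient_tendsto:
  fixes h h' :: "real \<Rightarrow> real" and D :: ereal
  assumes cont: "(h \<longlongrightarrow> h 0) (at_right 0)"
    and deriv: "\<And>t. 0 < t \<Longrightarrow> t < 1 \<Longrightarrow> (h has_real_derivative h' t) (at t)"
    and lim: "((\<lambda>t. ereal (h' t)) \<longlongrightarrow> D) (at_right 0)"
  shows "((\<lambda>s. ereal ((h s - h 0) / s)) \<longlongrightarrow> D) (at_right 0)"
proof -
  have ex: "\<exists>\<xi>. 0 < \<xi> \<and> \<xi> < s \<and> (h s - h 0) / s = h' \<xi>" if s: "0 < s" "s < 1" for s
  proof -
    have "isCont h t" if "0 < t" "t \<le> s" for t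
      using deriv[THEN DERIV_isCont] that s by auto
    then have c: "continuous_on {0..s} h"
      using cont s by (intro continuous_on_IccI)
        (auto simp: isCont_def intro: filterlim_mono[OF _ order_refl at_le])
    have "h differentiable at x" if "0 < x" "x < s" for x
      using deriv[of x] that s by (auto simp: real_differentiable_def)
    from MVT[OF s(1) c this]
    obtain l z where z: "0 < z" "z < s" "(h has_real_derivative l) (at z)" "h s - h 0 = (s - 0) * l"
      by blast
    moreover have "l = h' z"
      using z(1-3) s deriv[of z] by (intro DERIV_unique) auto
    ultimately show ?thesis using s by (intro exI[of _ z]) auto
  qed
  then obtain \<xi> where \<xi>: "0 < \<xi> s" "\<xi> s < s" "(h s - h 0) / s = h' (\<xi> s)" if "0 < s" "s < 1" for s
    by metis
  have ev: "\<forall>\<^sub>F s in at_right 0. 0 < s \<and> s < (1::real)"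
    by (auto simp: eventually_at_right_field intro!: exI[of _ 1])
  have "(\<xi> \<longlongrightarrow> 0) (at_right 0)"
    by (rule tendsto_sandwich[where f = "\<lambda>_. 0" and h = "\<lambda>s. s"])
      (use ev \<xi> in \<open>auto elim!: eventually_mono intro: less_imp_le\<close>)
  then have "filterlim \<xi> (at_right 0) (at_right 0)"
    unfolding filterlim_at using ev by (auto elim!: eventually_mono dest: \<xi>(1))
  from filterlim_compose[OF lim this] show ?thesis
    by (rule filterlim_mono_eventually) (use ev \<xi> in \<open>auto elim!: eventually_mono\<close>)
qed

section \<open>Bounds of powers by exponentials, as sources of dominating functions\<close>

text \<open>This is \<open>z \<le> exp z\<close> at \<open>z = c * y / k\<close>, raised to the
  power \<open>k\<close>.\<close>

lemma power_le_exp: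
  fixes y c :: real
  assumes "0 \<le> y" "0 < c"
  shows "y ^ k \<le> (real k / c) ^ k * exp (c * y)"
proof (cases "k = 0")
  case False
  then have "c * y / k \<le> exp (c * y / k)"
    using exp_ge_add_one_self[of "c * y / k"] by linarith
  then have "(c * y / k) ^ k \<le> exp (c * y / k) ^ k"
    using assms by (intro power_mono) auto
  also have "\<dots> = exp (c * y)" using False by (simp flip: exp_of_nat_mult)
  finally have "(real k / c) ^ k * (c * y / k) ^ k \<le> (real k / c) ^ k * exp (c * y)"
    using assms by (intro mult_left_mono) auto
  then show ?thesis using False assms by (simp flip: power_mult_distrib)
qed (use assms in auto)

text \<open>The distance \<open>a\<close> of \<open>t\<close> from 0 and 1 leaves room for a factor
  \<open>exp (a * \<bar>y\<bar>)\<close> that absorbs the power: the total exponent stays below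
  \<open>y\<close> for \<open>y \<ge> 0\<close> and below 0 for \<open>y < 0\<close>. The bound does
  not depend on \<open>t\<close>.\<close>

lemma power_exp_bound:
  fixes y t a :: real
  assumes "0 < a" "a \<le> t" "t \<le> 1 - a"
  shows "\<bar>y\<bar> ^ k * exp (t * y) \<le> (real k / a) ^ k * (1 + exp y)"
proof -
  have "\<bar>y\<bar> ^ k * exp (t * y) \<le> (real k / a) ^ k * exp (a * \<bar>y\<bar>) * exp (t * y)"
    using assms by (intro mult_right_mono power_le_exp) auto
  also have "\<dots> = (real k / a) ^ k * exp (a * \<bar>y\<bar> + t * y)" by (simp add: exp_add)
  also have "\<dots> \<le> (real k / a) ^ k * (1 + exp y)"
  proof (rule mult_left_mono)
    show "exp (a * \<bar>y\<bar> + t * y) \<le> 1 + exp y"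
    proof (cases "0 \<le> y")
      case True
      then have "(a + t) * y \<le> 1 * y" using assms by (intro mult_right_mono) auto
      then have "exp (a * \<bar>y\<bar> + t * y) \<le> exp y" using True by (simp add: algebra_simps)
      then show ?thesis by linarith
    next
      case False
      then have "(t - a) * y \<le> 0" using assms by (intro mult_nonneg_nonpos) auto
      then have "exp (a * \<bar>y\<bar> + t * y) \<le> 1" using False by (simp add: algebra_simps)
      then show ?thesis by (rule order_trans) simp
    qed
  qed (use assms in auto)
  finally show ?thesis .
qed

text \<open>One half of the exponent \<open>y\<close> pays for the power, the other for
  \<open>exp (s * y)\<close>. For nonnegative \<open>y\<close> this gives a bound that stays uniform
  down to \<open>s = 0\<close>.\<close>

lemma positive_power_exp_bound:
  fixes y s :: real
  assumes "0 \<le> s" "s \<le> 1 / 2" "0 \<le> y"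
  shows "y ^ k * exp (s * y) \<le> (2 * real k) ^ k * exp y"
proof -
  have "y ^ k * exp (s * y) \<le> ((real k / (1/2)) ^ k * exp (1/2 * y)) * exp (1/2 * y)"
    using assms by (intro mult_mono power_le_exp) (auto intro: mult_right_mono[of s "1/2" y, simplified])
  also have "\<dots> = (2 * real k) ^ k * exp y" by (simp add: mult.assoc mult.commute flip: exp_add)
  finally show ?thesis .
qed

section \<open>Moments under exponential weights: derivatives inside the interval and limits at
  0\<close>

text \<open>With \<open>N\<close> given by \<open>F dx\<close> on the common support and
  \<open>L = log G - log F\<close>, the assumption \<open>integrable_exp\<close> says that
  \<open>G\<close> is integrable there, and \<open>nonnull\<close> keeps the normalising constants
  positive.\<close>

locale exp_family = finite_measure N for N :: "'a measure" +
  fixes L :: "'a \<Rightarrow> real"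
  assumes L [measurable]: "L \<in> borel_measurable N"
    and integrable_exp: "integrable N (\<lambda>x. exp (L x))"
    and nonnull: "emeasure N (space N) \<noteq> 0"
begin

text \<open>For \<open>0 < t < 1\<close> this is the \<open>k\<close>-th derivative of the moment
  generating function \<open>moment 0\<close>. Integrability has to be tracked separately, since a
  divergent integral has the default value 0.\<close>

definition moment :: "nat \<Rightarrow> real \<Rightarrow> real" where
  "moment k t = (\<integral>x. L x ^ k * exp (t * L x) \<partial>N)"

lemma integrable_moment:
  assumes "0 < t" "t < 1"
  shows "integrable N (\<lambda>x. L x ^ k * exp (t * L x))"
proof (rule Bochner_Integration.integrable_bound)
  let ?a = "min t (1 - t)"
  show "integrable N (\<lambda>x. (real k / ?a) ^ k * (1 + exp (L x)))"
    using integrable_exp by auto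
  show "AE x in N. norm (L x ^ k * exp (t * L x)) \<le> norm ((real k / ?a) ^ k * (1 + exp (L x)))"
  proof (rule AE_I2)
    fix x
    show "norm (L x ^ k * exp (t * L x)) \<le> norm ((real k / ?a) ^ k * (1 + exp (L x)))"
      using power_exp_bound[of ?a t "L x" k] assms
      by (auto simp: abs_mult power_abs add_pos_pos intro: order_trans[OF _ abs_ge_self])
  qed
qed simp

lemma integrable_moment_right:
  assumes "integrable N (\<lambda>x. L x ^ k)" "0 \<le> t" "t < 1"
  shows "integrable N (\<lambda>x. L x ^ k * exp (t * L x))"
  using assms integrable_moment[of t k] by (cases "t = 0") auto

text \<open>Differentiation under the integral: the difference quotients of the integrand are
  bounded by its derivative on a neighbourhood \<open>T\<close> of \<open>t\<close>, and
  \<open>power_exp_bound\<close> dominates that derivative by one integrable function.\<close>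

lemma moment_DERIV:
  assumes t: "0 < t" "t < 1"
  shows "(moment k has_real_derivative moment (Suc k) t) (at t)"
proof -
  \<comment> \<open>Half the distance to the nearer end point, so that all of \<open>T\<close> keeps
    distance at least \<open>a\<close> from 0 and 1.\<close>
  define a where "a = min t (1 - t) / 2"
  define T where "T = {t - a<..<t + a}"
  have a: "0 < a" using t by (simp add: a_def)
  have T: "a \<le> s" "s \<le> 1 - a" "0 < s" "s < 1" if "s \<in> T" for s
    using that a unfolding T_def a_def by (auto simp: min_def field_simps split: if_splits)
  have Ls: "((\<lambda>s. \<integral>x. (L x ^ k * exp (s * L x) - L x ^ k * exp (t * L x)) / (s - t) \<partial>N)
      \<longlongrightarrow> (\<integral>x. L x ^ Suc k * exp (t * L x) \<partial>N)) (at t within T)"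
  proof (rule integral_tendsto_dominated)
    show "integrable N (\<lambda>x. (real (Suc k) / a) ^ Suc k * (1 + exp (L x)))"
      using integrable_exp by auto
  next
    fix x
    have d: "((\<lambda>s. L x ^ k * exp (s * L x)) has_real_derivative L x ^ Suc k * exp (s * L x)) (at s within T)" for s
      by (auto intro!: derivative_eq_intros simp: mult_ac)
    then show "((\<lambda>s. (L x ^ k * exp (s * L x) - L x ^ k * exp (t * L x)) / (s - t))
      \<longlongrightarrow> L x ^ Suc k * exp (t * L x)) (at t within T)"
      by (simp add: has_field_derivative_iff)
    fix s assume s: "s \<in> T - {t}"
    have "norm (L x ^ k * exp (s * L x) - L x ^ k * exp (t * L x))
        \<le> (real (Suc k) / a) ^ Suc k * (1 + exp (L x)) * norm (s - t)"
    proof (rule field_differentiable_bound[OF _ d])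
      show "convex T" by (simp add: T_def)
      show "t \<in> T" using a by (simp add: T_def)
      fix z assume "z \<in> T"
      from T[OF this] show "norm (L x ^ Suc k * exp (z * L x)) \<le> (real (Suc k) / a) ^ Suc k * (1 + exp (L x))"
        using power_exp_bound[OF a, of z "L x" "Suc k"] by (simp add: abs_mult power_abs)
    qed (use s in auto)
    then show "\<bar>(L x ^ k * exp (s * L x) - L x ^ k * exp (t * L x)) / (s - t)\<bar>
        \<le> (real (Suc k) / a) ^ Suc k * (1 + exp (L x))"
      using s by (simp add: abs_divide pos_divide_le_eq)
  qed simp_all
  have "((\<lambda>s. (moment k s - moment k t) / (s - t)) \<longlongrightarrow> moment (Suc k) t) (at t within T)"
    unfolding moment_def
    by (rule Lim_transform_within[OF Ls a])
      (use T t in \<open>auto simp: integrable_moment\<close>)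
  moreover have "at t within T = at t"
    using a by (intro at_within_open) (auto simp: T_def)
  ultimately show ?thesis by (simp add: has_field_derivative_iff)
qed

text \<open>Where \<open>L \<ge> 0\<close>, \<open>exp (L x)\<close> dominates up to a constant.
  Where \<open>L < 0\<close> the weight is at most 1 and only \<open>\<bar>L x ^ k\<bar>\<close>
  itself dominates, whence the assumption.\<close>

lemma moment_tendsto_right:
  assumes "integrable N (\<lambda>x. L x ^ k)"
  shows "(moment k \<longlongrightarrow> moment k 0) (at_right 0)"
proof -
  let ?T = "{0..1/2::real}"
  have "((\<lambda>s. \<integral>x. L x ^ k * exp (s * L x) \<partial>N) \<longlongrightarrow> (\<integral>x. L x ^ k * exp (0 * L x) \<partial>N)) (at 0 within ?T)"
  proof (rule integral_tendsto_dominated)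
    show "integrable N (\<lambda>x. \<bar>L x ^ k\<bar> + (2 * real k) ^ k * exp (L x))"
      using assms integrable_exp by auto
    fix x
    show "((\<lambda>s. L x ^ k * exp (s * L x)) \<longlongrightarrow> L x ^ k * exp (0 * L x)) (at 0 within ?T)"
      by (intro tendsto_intros)
    fix s assume s: "s \<in> ?T - {0}"
    show "\<bar>L x ^ k * exp (s * L x)\<bar> \<le> \<bar>L x ^ k\<bar> + (2 * real k) ^ k * exp (L x)"
    proof (cases "0 \<le> L x")
      case True
      then show ?thesis using positive_power_exp_bound[of s "L x" k] s
        by (auto simp: abs_mult intro: add_increasing)
    next
      case False
      then have "s * L x \<le> 0" using s by (intro mult_nonneg_nonpos) auto
      then have "\<bar>L x ^ k * exp (s * L x)\<bar> \<le> \<bar>L x ^ k\<bar>" by (simp add: abs_mult mult_left_le)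
      then show ?thesis by (rule order_trans) simp
    qed
  qed simp_all
  then show ?thesis unfolding moment_def[abs_def] using at_within_Icc_at_right[of 0 "1/2::real"] by simp
qed

text \<open>Fatou's lemma along sequences tending to 0; the absolute value makes the integrands
  nonnegative.\<close>

lemma moment_infinite_right:
  assumes "\<not> integrable N (\<lambda>x. L x ^ k)"
  shows "((\<lambda>s. ereal (\<integral>x. \<bar>L x\<bar> ^ k * exp (s * L x) \<partial>N)) \<longlongrightarrow> \<infinity>) (at_right 0)"
proof -
  have inf: "(\<integral>\<^sup>+x. ennreal (\<bar>L x\<bar> ^ k) \<partial>N) = \<infinity>"
    using assms by (auto simp: integrable_iff_bounded power_abs not_less top_unique)
  have *: "\<forall>\<^sub>F n in sequentially. ereal r < ereal (\<integral>x. \<bar>L x\<bar> ^ k * exp (X n * L x) \<partial>N)"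
    if X: "\<And>n. 0 < X n" "\<And>n. X n < 1" "X \<longlonglongrightarrow> 0" for r X
  proof -
    have "liminf (\<lambda>n. ennreal (\<bar>L x\<bar> ^ k * exp (X n * L x))) = ennreal (\<bar>L x\<bar> ^ k)" for x
    proof (rule lim_imp_Liminf)
      have "(\<lambda>n. \<bar>L x\<bar> ^ k * exp (X n * L x)) \<longlonglongrightarrow> \<bar>L x\<bar> ^ k * exp (0 * L x)"
        by (intro tendsto_intros X)
      then show "(\<lambda>n. ennreal (\<bar>L x\<bar> ^ k * exp (X n * L x))) \<longlonglongrightarrow> ennreal (\<bar>L x\<bar> ^ k)"
        by (intro tendsto_ennrealI) simp
    qed simp
    then have "\<infinity> \<le> liminf (\<lambda>n. \<integral>\<^sup>+x. ennreal (\<bar>L x\<bar> ^ k * exp (X n * L x)) \<partial>N)"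
      using nn_integral_liminf[of "\<lambda>n x. ennreal (\<bar>L x\<bar> ^ k * exp (X n * L x))" N] inf by simp
    \<comment> \<open>The threshold is made nonnegative so that the comparison can be carried back
      from \<open>ennreal\<close> to the reals.\<close>
    then have "\<forall>\<^sub>F n in sequentially. ennreal (max r 0) < (\<integral>\<^sup>+x. ennreal (\<bar>L x\<bar> ^ k * exp (X n * L x)) \<partial>N)"
      by (auto simp: le_Liminf_iff top.extremum_unique)
    moreover have "(\<integral>\<^sup>+x. ennreal (\<bar>L x\<bar> ^ k * exp (X n * L x)) \<partial>N)
        = ennreal (\<integral>x. \<bar>L x\<bar> ^ k * exp (X n * L x) \<partial>N)" for n
    proof (rule nn_integral_eq_integral)
      show "integrable N (\<lambda>x. \<bar>L x\<bar> ^ k * exp (X n * L x))"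
        using integrable_abs[OF integrable_moment[OF X(1,2), of k n]] by (simp add: abs_mult power_abs)
    qed simp
    ultimately show ?thesis
      by (auto elim!: eventually_mono simp: ennreal_less_iff)
  qed
  show ?thesis
    unfolding tendsto_PInfty
    by (intro allI sequentially_imp_eventually_at_right[of 0 1]) (use * in auto)
qed


section \<open>The logarithm of the moment generating function, its derivatives and the tilted
  measures\<close>

definition cumulant :: "real \<Rightarrow> real" where
  "cumulant t = ln (moment 0 t)"

definition mean :: "real \<Rightarrow> real" where
  "mean t = moment 1 t / moment 0 t"

definition var :: "real \<Rightarrow> real" where
  "var t = moment 2 t / moment 0 t - (mean t)\<^sup>2"

text \<open>The probability measure under which \<open>L\<close> has expectation
  \<open>mean t\<close> and, if square integrable, variance \<open>var t\<close>. It is later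
  identified with \<open>mu F G t\<close>.\<close>

definition tilt :: "real \<Rightarrow> 'a measure" where
  "tilt t = density N (\<lambda>x. ennreal (exp (t * L x) / moment 0 t))"

lemma moment_0_pos:
  assumes "0 \<le> t" "t < 1"
  shows "0 < moment 0 t"
proof -
  have i: "integrable N (\<lambda>x. exp (t * L x))"
    using integrable_moment_right[of 0 t] assms by simp
  have "(\<integral>x. exp (t * L x) \<partial>N) \<noteq> 0"
    using integral_nonneg_eq_0_iff_AE[OF i] nonnull by (auto simp: AE_iff_null)
  then show ?thesis
    unfolding moment_def 
    using Bochner_Integration.integral_nonneg[of N "\<lambda>x. exp (t * L x)"] by (simp add: less_le)
qed

lemma cumulant_DERIV:
  assumes "0 < t" "t < 1"
  shows "(cumulant has_real_derivative mean t) (at t)"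
  unfolding cumulant_def[abs_def] mean_def
  using moment_DERIV[of t 0] moment_0_pos[of t] assms
  by (auto intro!: derivative_eq_intros)

lemma mean_DERIV:
  assumes "0 < t" "t < 1"
  shows "(mean has_real_derivative var t) (at t)"
  unfolding mean_def[abs_def] var_def
  by (rule derivative_eq_intros moment_DERIV assms refl)+
    (use moment_0_pos[of t] assms in \<open>auto simp: field_simps power2_eq_square numeral_2_eq_2\<close>)

lemma moment_0_tendsto: "(moment 0 \<longlongrightarrow> moment 0 0) (at_right 0)"
  by (rule moment_tendsto_right) simp

lemma cumulant_tendsto: "(cumulant \<longlongrightarrow> cumulant 0) (at_right 0)"
  unfolding cumulant_def[abs_def]
  by (intro tendsto_intros moment_0_tendsto) (use moment_0_pos[of 0] in auto)

lemma mean_tendsto: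
  assumes "integrable N L"
  shows "(mean \<longlongrightarrow> mean 0) (at_right 0)"
  unfolding mean_def[abs_def]
  by (intro tendsto_divide moment_0_tendsto moment_tendsto_right)
    (use assms moment_0_pos[of 0] in auto)

text \<open>The positive part of \<open>L\<close> contributes boundedly, because
  \<open>exp (L x)\<close> is integrable; the divergence of the absolute moment therefore comes from
  the negative part.\<close>

lemma mean_tendsto_MInfty:
  assumes "\<not> integrable N L"
  shows "((\<lambda>s. ereal (mean s)) \<longlongrightarrow> -\<infinity>) (at_right 0)"
proof -
  \<comment> \<open>The factor 4 is 2 times 2: \<open>L + \<bar>L\<bar>\<close> is twice the
    positive part, and \<open>positive_power_exp_bound\<close> has the constant 2 for
    \<open>k = 1\<close>.\<close>
  let ?A = "\<lambda>s. \<integral>x. \<bar>L x\<bar> ^ 1 * exp (s * L x) \<partial>N" and ?C = "4 * (\<integral>x. exp (L x) \<partial>N)"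
  have A: "filterlim ?A at_top (at_right 0)"
    using moment_infinite_right[of 1] assms by (simp add: tendsto_PInfty_eq_at_top)
  have le: "moment 1 s \<le> ?C - ?A s" if s: "0 < s" "s < 1 / 2" for s
  proof -
    have i: "integrable N (\<lambda>x. L x * exp (s * L x))"
      using integrable_moment[of s 1] s by simp
    have i': "integrable N (\<lambda>x. \<bar>L x\<bar> * exp (s * L x))"
      using integrable_abs[OF i] by (simp add: abs_mult)
    have "moment 1 s + ?A s = (\<integral>x. L x * exp (s * L x) + \<bar>L x\<bar> * exp (s * L x) \<partial>N)"
      unfolding moment_def using i i' by simp
    also have "\<dots> \<le> (\<integral>x. 4 * exp (L x) \<partial>N)"
    proof (rule integral_mono)
      fix x
      show "L x * exp (s * L x) + \<bar>L x\<bar> * exp (s * L x) \<le> 4 * exp (L x)"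
        using positive_power_exp_bound[of s "L x" 1] s by (cases "0 \<le> L x") auto
    qed (use i i' integrable_exp in auto)
    finally show ?thesis by simp
  qed
  have "filterlim (\<lambda>s. ?A s - ?C) at_top (at_right 0)"
    using filterlim_tendsto_add_at_top[OF tendsto_const[of "- ?C"] A] by (simp add: algebra_simps)
  moreover have "\<forall>\<^sub>F s in at_right 0. ?A s - ?C \<le> - moment 1 s"
    using le by (auto simp: eventually_at_right_field algebra_simps intro!: exI[of _ "1/2"])
  ultimately have "filterlim (\<lambda>s. - moment 1 s) at_top (at_right 0)"
    by (rule filterlim_at_top_mono)
  moreover have "((\<lambda>s. inverse (moment 0 s)) \<longlongrightarrow> inverse (moment 0 0)) (at_right 0)"
    by (intro tendsto_inverse moment_0_tendsto) (use moment_0_pos[of 0] in auto)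
  ultimately have "filterlim (\<lambda>s. inverse (moment 0 s) * - moment 1 s) at_top (at_right 0)"
    using filterlim_tendsto_pos_mult_at_top moment_0_pos[of 0]
    by (metis inverse_positive_iff_positive order_refl zero_less_one)
  then have "((\<lambda>s. - ereal (inverse (moment 0 s) * - moment 1 s)) \<longlongrightarrow> - \<infinity>) (at_right 0)"
    unfolding tendsto_PInfty_eq_at_top[symmetric] by (rule tendsto_uminus_ereal)
  then show ?thesis by (simp add: mean_def divide_inverse mult.commute)
qed

lemma integrable_tilt:
  fixes h :: "'a \<Rightarrow> real"
  assumes [measurable]: "h \<in> borel_measurable N" and "0 \<le> t" "t < 1"
  shows "integrable (tilt t) h \<longleftrightarrow> integrable N (\<lambda>x. h x * exp (t * L x))"
proof -
  have "integrable (tilt t) h \<longleftrightarrow> integrable N (\<lambda>x. inverse (moment 0 t) * (h x * exp (t * L x)))"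
    using moment_0_pos[of t] assms(2,3) unfolding tilt_def
    by (subst integrable_density) (auto simp: divide_inverse mult_ac)
  then show ?thesis using moment_0_pos[of t] assms(2,3) by (simp only: integrable_mult_right_iff) simp
qed

lemma integral_tilt:
  fixes h :: "'a \<Rightarrow> real"
  assumes [measurable]: "h \<in> borel_measurable N" and "0 \<le> t" "t < 1"
  shows "(\<integral>x. h x \<partial>tilt t) = (\<integral>x. h x * exp (t * L x) \<partial>N) / moment 0 t"
  using moment_0_pos[of t] assms(2,3) unfolding tilt_def
  by (subst integral_density) (auto simp: mult.commute)

lemma ext_variance_tilt:
  assumes t: "0 \<le> t" "t < 1"
  shows "ext_variance (tilt t) (\<lambda>x. ereal (L x)) =
    (if integrable N (\<lambda>x. (L x)\<^sup>2 * exp (t * L x)) then ereal (var t) else \<infinity>)"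
proof (cases "integrable N (\<lambda>x. (L x)\<^sup>2 * exp (t * L x))")
  case True
  then have "integrable (tilt t) (\<lambda>x. (L x)\<^sup>2)" using t by (simp add: integrable_tilt)
  then show ?thesis using True t
    by (simp add: ext_variance_ereal integral_tilt var_def mean_def moment_def)
next
  case False
  then have "\<not> integrable (tilt t) (\<lambda>x. (L x)\<^sup>2)" using t by (simp add: integrable_tilt)
  then have "(\<integral>\<^sup>+x. ennreal ((L x)\<^sup>2) \<partial>tilt t) = \<infinity>"
    by (auto simp: integrable_iff_bounded tilt_def not_less top_unique)
  moreover have "e2ennreal ((ereal (L x))\<^sup>2) = ennreal ((L x)\<^sup>2)" for x
    by (simp flip: ennreal.abs_eq)
  ultimately show ?thesis using False by (simp add: ext_variance_def)
qed

text \<open>Integrability of \<open>L\<close> makes \<open>mean\<close> converge to a finite limit,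
  so the second moment alone decides: it converges if \<open>L\<close> is square integrable and
  tends to \<infinity> otherwise.\<close>

lemma var_tendsto:
  assumes i: "integrable N L"
  shows "((\<lambda>s. ereal (var s)) \<longlongrightarrow> ext_variance (tilt 0) (\<lambda>x. ereal (L x))) (at_right 0)"
proof (cases "integrable N (\<lambda>x. (L x)\<^sup>2)")
  case True
  have "(var \<longlongrightarrow> var 0) (at_right 0)"
    unfolding var_def[abs_def]
    by (intro tendsto_intros mean_tendsto moment_0_tendsto moment_tendsto_right i True)
      (use moment_0_pos[of 0] in auto)
  then show ?thesis using True by (simp add: ext_variance_tilt)
next
  case False
  have m: "moment 2 = (\<lambda>s. \<integral>x. \<bar>L x\<bar> ^ 2 * exp (s * L x) \<partial>N)"
    by (simp add: moment_def[abs_def])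
  have "filterlim (moment 2) at_top (at_right 0)"
    using moment_infinite_right[of 2] False unfolding m by (simp add: tendsto_PInfty_eq_at_top)
  moreover have "((\<lambda>s. inverse (moment 0 s)) \<longlongrightarrow> inverse (moment 0 0)) (at_right 0)"
    by (intro tendsto_inverse moment_0_tendsto) (use moment_0_pos[of 0] in auto)
  ultimately have *: "filterlim (\<lambda>s. inverse (moment 0 s) * moment 2 s) at_top (at_right 0)"
    using filterlim_tendsto_pos_mult_at_top moment_0_pos[of 0]
    by (metis inverse_positive_iff_positive order_refl zero_less_one)
  have "((\<lambda>s. - (mean s)\<^sup>2) \<longlongrightarrow> - (mean 0)\<^sup>2) (at_right 0)"
    by (intro tendsto_intros mean_tendsto i)
  from filterlim_tendsto_add_at_top[OF this *]
  have "filterlim var at_top (at_right 0)"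
    by (simp add: var_def[abs_def] divide_inverse mult.commute)
  then show ?thesis using False by (simp add: ext_variance_tilt tendsto_PInfty_eq_at_top)
qed

end

subsection \<open>Extended-valued logarithms, variances and derivatives\<close>

lemma elog_ereal: "0 < a \<Longrightarrow> elog (ennreal a) = ereal (ln a)"
  by (simp add: elog_def)

lemma elog_mono_ennreal: "a \<le> ennreal b \<Longrightarrow> 0 < b \<Longrightarrow> elog a \<le> ereal (ln b)"
  by (cases a rule: ennreal_cases) (auto simp: elog_def top_unique)

lemma measurable_elog [measurable]: "elog \<in> borel_measurable borel"
  unfolding elog_def[abs_def] by measurable

lemma measurable_log_ratio [measurable]:
  assumes [measurable]: "F \<in> borel_measurable M" "G \<in> borel_measurable M"
  shows "log_ratio F G \<in> borel_measurable M"
  unfolding log_ratio_def[abs_def] by measurable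

lemma ext_variance_cong_AE:
  assumes [measurable]: "H \<in> borel_measurable M" "H' \<in> borel_measurable M"
    and eq: "AE x in M. H x = H' x"
  shows "ext_variance M H = ext_variance M H'"
proof -
  have "(\<integral>\<^sup>+x. e2ennreal ((H x)\<^sup>2) \<partial>M) = (\<integral>\<^sup>+x. e2ennreal ((H' x)\<^sup>2) \<partial>M)"
    using eq by (intro nn_integral_cong_AE) auto
  moreover have "(\<integral>x. real_of_ereal (H x) \<partial>M) = (\<integral>x. real_of_ereal (H' x) \<partial>M)"
    using eq by (intro integral_cong_AE) auto
  ultimately show ?thesis by (simp only: ext_variance_def)
qed

text \<open>Where both functions vanish, \<open>log_ratio\<close> is \<infinity> in either order, so
  it is not antisymmetric there. Its square and its real part still transform correctly, and the
  variance sees only these.\<close>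

lemma ext_variance_log_ratio_swap:
  "ext_variance M (log_ratio G F) = ext_variance M (log_ratio F G)"
proof -
  have "(log_ratio G F x)\<^sup>2 = (log_ratio F G x)\<^sup>2 \<and>
      real_of_ereal (log_ratio G F x) = - real_of_ereal (log_ratio F G x)" for x
    unfolding log_ratio_def elog_def by (simp add: power2_eq_square algebra_simps)
  then show ?thesis by (simp add: ext_variance_def Let_def)
qed

lemma has_ext_derivative_at_0I:
  assumes "\<And>s. 0 < s \<Longrightarrow> s < 1 \<Longrightarrow> (\<phi> s - \<phi> 0) / ereal s = Q s"
    and "(Q \<longlongrightarrow> d) (at_right 0)"
  shows "has_ext_derivative \<phi> d 0 {0..1}"
proof -
  have "\<forall>\<^sub>F s in at_right 0. Q s = (\<phi> s - \<phi> 0) / ereal (s - 0)"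
    using assms(1) by (auto simp: eventually_at_right_field intro!: exI[of _ 1])
  from Lim_transform_eventually[OF assms(2) this] show ?thesis
    by (simp add: has_ext_derivative_def at_within_Icc_at_right)
qed

lemma has_ext_derivative_interiorI:
  assumes eq: "\<And>t. 0 < t \<Longrightarrow> t < 1 \<Longrightarrow> \<phi> t = ereal (h t)"
    and h: "(h has_real_derivative d) (at \<theta>)" and \<theta>: "0 < \<theta>" "\<theta> < 1"
  shows "has_ext_derivative \<phi> (ereal d) \<theta> {0..1}"
proof -
  have "((\<lambda>s. (ereal (h s) - ereal (h \<theta>)) / ereal (s - \<theta>)) \<longlongrightarrow> ereal d) (at \<theta>)"
    using h has_ext_derivative_ereal[of h d \<theta> UNIV] by (simp add: has_ext_derivative_def)
  moreover have "\<forall>\<^sub>F s in at \<theta>. (ereal (h s) - ereal (h \<theta>)) / ereal (s - \<theta>) = (\<phi> s - \<phi> \<theta>) / ereal (s - \<theta>)"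
    using eventually_at_in_open[of "{0<..<1}" \<theta>] \<theta> by (auto elim!: eventually_mono simp: eq)
  ultimately show ?thesis
    using \<theta> by (simp add: has_ext_derivative_def at_within_Icc_at Lim_transform_eventually)
qed

text \<open>The chain rule for \<open>t \<mapsto> 1 - t\<close>, done on extended quotients: the
  numerator is kept and the increment changes sign.\<close>

lemma has_ext_derivative_reflect:
  assumes "has_ext_derivative (\<lambda>t. \<phi> (1 - t)) d 0 {0..1}"
  shows "has_ext_derivative \<phi> (- d) 1 {0..1}"
proof -
  have "((\<lambda>s::real. 1 - s) \<longlongrightarrow> 1 - 1) (at 1 within {0..1})"
    by (intro tendsto_intros)
  then have "filterlim (\<lambda>s::real. 1 - s) (at 0 within {0..1}) (at 1 within {0..1})"
    by (auto simp: filterlim_at eventually_at_filter)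
  from filterlim_compose[OF assms[unfolded has_ext_derivative_def] this]
  have "((\<lambda>s. - ((\<phi> s - \<phi> 1) / ereal (1 - s))) \<longlongrightarrow> - d) (at 1 within {0..1})"
    by (intro tendsto_uminus_ereal) simp
  moreover have "- (a / ereal (1 - s)) = a / ereal (s - 1)" if "s \<noteq> 1" for a s
  proof -
    have "inverse (s - 1) = - inverse (1 - s)"
      by (metis inverse_minus_eq minus_diff_eq)
    then have "ereal (inverse (s - 1)) = - ereal (inverse (1 - s))" by simp
    then show ?thesis using that by (simp add: divide_ereal_def del: uminus_ereal.simps)
  qed
  ultimately show ?thesis
    unfolding has_ext_derivative_def
    by (elim Lim_transform_eventually) (auto simp: eventually_at_filter)
qed

text \<open>Negation distributes over an extended difference unless it has the form \<infinity> -
  \<infinity>. Finiteness near \<open>\<theta>\<close> excludes this and still allows an infinite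
  value at \<open>\<theta>\<close>.\<close>

lemma has_ext_derivative_uminus:
  assumes "has_ext_derivative \<phi> d \<theta> S" and fin: "\<forall>\<^sub>F s in at \<theta> within S. \<bar>\<phi> s\<bar> \<noteq> \<infinity>"
  shows "has_ext_derivative (\<lambda>t. - \<phi> t) (- d) \<theta> S"
proof -
  have "((\<lambda>s. - ((\<phi> s - \<phi> \<theta>) / ereal (s - \<theta>))) \<longlongrightarrow> - d) (at \<theta> within S)"
    using assms(1) by (intro tendsto_uminus_ereal) (simp add: has_ext_derivative_def)
  moreover have "\<forall>\<^sub>F s in at \<theta> within S.
      - ((\<phi> s - \<phi> \<theta>) / ereal (s - \<theta>)) = (- \<phi> s - - \<phi> \<theta>) / ereal (s - \<theta>)"
  proof (rule eventually_mono[OF fin])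
    fix s assume "\<bar>\<phi> s\<bar> \<noteq> \<infinity>"
    then have "- \<phi> s - - \<phi> \<theta> = - (\<phi> s - \<phi> \<theta>)"
      by (cases "\<phi> s"; cases "\<phi> \<theta>") auto
    then show "- ((\<phi> s - \<phi> \<theta>) / ereal (s - \<theta>)) = (- \<phi> s - - \<phi> \<theta>) / ereal (s - \<theta>)"
      by (simp add: ereal_uminus_divide)
  qed
  ultimately show ?thesis
    unfolding has_ext_derivative_def by (rule Lim_transform_eventually)
qed

section \<open>The interpolated integrand and the log-convexity of its integral\<close>

lemma interp_measurable [measurable]:
  assumes [measurable]: "F \<in> borel_measurable M" "G \<in> borel_measurable M"
  shows "interp F G \<theta> \<in> borel_measurable M"
  unfolding interp_def[abs_def] by measurable

lemma interp_nonneg: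
  assumes "0 \<le> F x" "0 \<le> G x"
  shows "0 \<le> interp F G \<theta> x"
  using assms by (simp add: interp_def)

lemma interp_pos:
  assumes "0 < F x" "0 < G x"
  shows "interp F G \<theta> x = exp ((1 - \<theta>) * ln (F x) + \<theta> * ln (G x))"
  using assms by (simp add: interp_def powr_def exp_add)

lemma interp_swap: "interp G F (1 - \<theta>) = interp F G \<theta>"
  by (auto simp: interp_def)

lemma Z_swap: "Z G F (1 - \<theta>) = Z F G \<theta>"
  by (simp add: Z_def interp_swap)

lemma mu_swap: "mu G F (1 - \<theta>) = mu F G \<theta>"
  by (simp add: mu_def interp_swap Z_swap)

text \<open>Where \<open>F\<close> and \<open>G\<close> are both positive, the logarithm of the
  integrand is affine in the parameter and equality holds. Elsewhere, if
  \<open>x \<noteq> y\<close>, the intermediate parameter is strictly between 0 and 1 and the left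
  side is 0.\<close>

lemma interp_log_convex:
  assumes F: "0 \<le> F z" and G: "0 \<le> G z" and xy: "x \<in> {0..1}" "y \<in> {0..1}"
    and uv: "0 < u" "0 < v" "u + v = 1"
  shows "interp F G (u * x + v * y) z \<le> interp F G x z powr u * interp F G y z powr v"
proof -
  have one: "a powr u * a powr v = a" if "0 \<le> a" for a
    using that uv by (cases "a = 0") (auto simp flip: powr_add)
  consider "x = y" | "x \<noteq> y" "F z = 0 \<or> G z = 0" | "0 < F z" "0 < G z"
    using F G by fastforce
  then show ?thesis
  proof cases
    case 1
    then have "u * x + v * y = x" using uv by (simp flip: distrib_right)
    then show ?thesis using 1 one[of "interp F G x z"] interp_nonneg[of F z G x] F G by simp
  next
    case 2
    have "0 < u * x + v * y"
      using 2 xy uv by (cases "x = 0") (auto intro: add_pos_nonneg)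
    moreover have "0 < u * (1 - x) + v * (1 - y)"
      using 2 xy uv by (cases "x = 1") (auto intro: add_pos_nonneg)
    then have "u * x + v * y < 1" using uv by (simp add: algebra_simps)
    ultimately have "interp F G (u * x + v * y) z = 0"
      using 2 by (auto simp: interp_def)
    then show ?thesis by simp
  next
    case 3
    have v: "v = 1 - u" using uv by simp
    show ?thesis
      unfolding interp_pos[of F z G, OF 3] powr_def by (simp add: v algebra_simps flip: exp_add)
  qed
qed

lemma Youngs_inequality_nonneg:
  fixes a b :: real
  assumes "0 \<le> u" "0 \<le> v" "u + v = 1" "0 \<le> a" "0 \<le> b"
  shows "a powr u * b powr v \<le> u * a + v * b"
  using Youngs_inequality_0[of u v a b] assms by (cases "a = 0 \<or> b = 0") auto

lemma interp_le_add:
  assumes "0 \<le> F x" "0 \<le> G x" "0 \<le> \<theta>" "\<theta> \<le> 1"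
  shows "interp F G \<theta> x \<le> F x + G x"
proof -
  have "interp F G \<theta> x \<le> (1 - \<theta>) * F x + \<theta> * G x"
    using Youngs_inequality_nonneg[of "1 - \<theta>" \<theta> "F x" "G x"] assms
    by (cases "\<theta> = 0 \<or> \<theta> = 1") (auto simp: interp_def)
  also have "\<dots> \<le> F x + G x"
    using mult_right_mono[of "1 - \<theta>" 1 "F x"] mult_right_mono[of \<theta> 1 "G x"] assms by simp
  finally show ?thesis .
qed

lemma Z_finite:
  assumes [measurable]: "F \<in> borel_measurable lebesgue" "G \<in> borel_measurable lebesgue"
    and nonneg: "\<And>x. 0 \<le> F x" "\<And>x. 0 \<le> G x"
    and fin: "Z F G 0 < \<infinity>" "Z F G 1 < \<infinity>" and \<theta>: "\<theta> \<in> {0..1}"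
  shows "Z F G \<theta> < \<infinity>"
proof -
  have "Z F G \<theta> \<le> (\<integral>\<^sup>+x. ennreal (F x) + ennreal (G x) \<partial>lebesgue)"
    unfolding Z_def using interp_le_add[of F _ G \<theta>] nonneg \<theta>
    by (intro nn_integral_mono) (simp flip: ennreal_plus)
  also have "\<dots> = Z F G 0 + Z F G 1"
    by (subst nn_integral_add) (auto simp: Z_def interp_def)
  finally show ?thesis using fin by (auto simp: less_top[symmetric] top_unique)
qed

text \<open>Hoelder's inequality with exponents \<open>1 / u\<close> and \<open>1 / v\<close>, in
  its usual proof: Young's inequality for the integrands normalised by their integrals, then
  integration.\<close>

lemma Z_log_convex:
  assumes [measurable]: "F \<in> borel_measurable lebesgue" "G \<in> borel_measurable lebesgue"
    and nonneg: "\<And>x. 0 \<le> F x" "\<And>x. 0 \<le> G x"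
    and fin: "Z F G 0 < \<infinity>" "Z F G 1 < \<infinity>"
  shows "ext_convex_on {0..1} (\<lambda>\<theta>. elog (Z F G \<theta>))"
  unfolding ext_convex_on_def
proof (intro conjI ballI allI impI)
  fix x y u v :: real
  assume xy: "x \<in> {0..1}" "y \<in> {0..1}" and uv: "0 \<le> u" "0 \<le> v" "u + v = 1"
  let ?t = "u * x + v * y"
  have i: "interp F G ?t z \<le> interp F G x z powr u * interp F G y z powr v" if "0 < u" "0 < v" for z
    by (rule interp_log_convex) (use nonneg xy uv that in auto)
  consider "u = 0" | "v = 0" | "0 < u" "0 < v" "Z F G x = 0 \<or> Z F G y = 0"
    | "0 < u" "0 < v" "Z F G x \<noteq> 0" "Z F G y \<noteq> 0"
    using uv by fastforce
  then show "elog (Z F G (u *\<^sub>R x + v *\<^sub>R y)) \<le> ereal u * elog (Z F G x) + ereal v * elog (Z F G y)"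
  proof cases
    \<comment> \<open>If one of the two integrals is 0, the integrand at the intermediate parameter
      vanishes almost everywhere, so the left side is \<open>- \<infinity>\<close>.\<close>
    case 3
    have "AE z in lebesgue. interp F G x z \<le> 0 \<or> interp F G y z \<le> 0"
      using 3(3) by (auto simp: Z_def nn_integral_0_iff_AE ennreal_eq_0_iff)
    then have "AE z in lebesgue. interp F G ?t z \<le> 0"
    proof eventually_elim
      case (elim z)
      then have "interp F G x z = 0 \<or> interp F G y z = 0"
        using interp_nonneg[of F z G] nonneg by (meson order_antisym)
      then show ?case using i[OF 3(1,2), of z] by auto
    qed
    then have "Z F G ?t = 0"
      by (simp add: Z_def nn_integral_0_iff_AE ennreal_eq_0_iff)
    then show ?thesis by (simp add: elog_def)
  next
    case 4
    obtain a b where ab: "Z F G x = ennreal a" "Z F G y = ennreal b" "0 < a" "0 < b"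
    proof -
      have "\<exists>a>0. Z F G s = ennreal a" if "s \<in> {0..1}" "Z F G s \<noteq> 0" for s
        using Z_finite[OF assms that(1)] that(2)
        by (cases "Z F G s" rule: ennreal_cases) (auto intro!: exI[of _ "enn2real (Z F G s)"] simp: less_le)
      then show thesis using that 4 xy by blast
    qed
    \<comment> \<open>The bound to be reached. The coefficients \<open>c * u / a\<close> and
      \<open>c * v / b\<close> below make the integrated right side equal to
      \<open>c * u + c * v = c\<close>.\<close>
    define c where "c = a powr u * b powr v"
    have c: "0 < c" using ab by (simp add: c_def)
    have "ennreal (interp F G ?t z) \<le> ennreal (c * u / a) * ennreal (interp F G x z)
        + ennreal (c * v / b) * ennreal (interp F G y z)" for z
    proof -
      have n: "0 \<le> interp F G x z" "0 \<le> interp F G y z" by (simp_all add: interp_nonneg nonneg)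
      have "interp F G x z powr u * interp F G y z powr v
          = c * ((interp F G x z / a) powr u * (interp F G y z / b) powr v)"
        using ab n by (simp add: c_def powr_divide)
      also have "\<dots> \<le> c * (u * (interp F G x z / a) + v * (interp F G y z / b))"
        using uv n ab c by (intro mult_left_mono Youngs_inequality_nonneg) auto
      finally have "interp F G ?t z \<le> c * u / a * interp F G x z + c * v / b * interp F G y z"
        using i[OF 4(1,2), of z] by (simp add: algebra_simps)
      then have "ennreal (interp F G ?t z) \<le> ennreal (c * u / a * interp F G x z + c * v / b * interp F G y z)"
        by (rule ennreal_leI)
      then show ?thesis using n c uv ab by (simp add: ennreal_mult[symmetric] flip: ennreal_plus)
    qed
    then have "Z F G ?t \<le> (\<integral>\<^sup>+z. ennreal (c * u / a) * ennreal (interp F G x z)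
        + ennreal (c * v / b) * ennreal (interp F G y z) \<partial>lebesgue)"
      unfolding Z_def by (intro nn_integral_mono)
    also have "\<dots> = ennreal (c * u / a) * Z F G x + ennreal (c * v / b) * Z F G y"
      by (subst nn_integral_add) (auto simp: Z_def nn_integral_cmult)
    also have "\<dots> = ennreal (c * u + c * v)"
      using ab c uv by (simp flip: ennreal_plus ennreal_mult)
    also have "c * u + c * v = c" using uv by (simp flip: distrib_left)
    finally have "elog (Z F G ?t) \<le> ereal (ln c)"
      using elog_mono_ennreal c by simp
    also have "ln c = u * ln a + v * ln b"
      using ab by (simp add: c_def ln_mult ln_powr)
    finally show ?thesis using ab by (simp add: elog_ereal)
  qed (use uv in \<open>auto simp flip: zero_ereal_def one_ereal_def\<close>)
qed simp

subsection \<open>Interpolating two densities\<close>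

text \<open>For every parameter strictly between 0 and 1 the integrand is positive exactly where
  both functions are, so \<open>overlap\<close> at the midpoint says that the common support is not
  null.\<close>

locale overlapping_pair =
  fixes F G :: "'a::euclidean_space \<Rightarrow> real"
  assumes F [measurable]: "F \<in> borel_measurable lebesgue"
    and G [measurable]: "G \<in> borel_measurable lebesgue"
    and F_nonneg: "\<And>x. 0 \<le> F x" and G_nonneg: "\<And>x. 0 \<le> G x"
    and Z_0_finite: "Z F G 0 < \<infinity>" and Z_1_finite: "Z F G 1 < \<infinity>"
    and overlap: "0 < Z F G (1 / 2)"
begin

text \<open>The restriction of \<open>F\<close> to the common support, expressed by the density so
  that the underlying space stays the same.\<close>

definition weight :: "'a \<Rightarrow> real" where
  "weight x = (if G x = 0 then 0 else F x)"

definition base :: "'a measure" where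
  "base = density lebesgue (\<lambda>x. ennreal (weight x))"

text \<open>A real-valued version of \<open>log_ratio\<close>; the default \<open>ln 0 = 0\<close>
  is used only where \<open>weight\<close> vanishes.\<close>

definition logr :: "'a \<Rightarrow> real" where
  "logr x = ln (G x) - ln (F x)"

lemma weight_measurable [measurable]: "weight \<in> borel_measurable lebesgue"
  unfolding weight_def[abs_def] by measurable

lemma logr_measurable [measurable]: "logr \<in> borel_measurable lebesgue"
  unfolding logr_def[abs_def] by measurable

lemma borel_measurable_base [simp]: "borel_measurable base = borel_measurable lebesgue"
  by (rule measurable_cong_sets) (simp_all add: base_def)

lemma weight_nonneg: "0 \<le> weight x"
  by (simp add: weight_def F_nonneg)

lemma weight_le: "weight x \<le> F x"
  by (simp add: weight_def F_nonneg)

lemma weight_exp_le: "weight x * exp (logr x) \<le> G x"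
  using F_nonneg[of x] G_nonneg[of x]
  by (cases "F x = 0 \<or> G x = 0") (auto simp: weight_def logr_def exp_diff)

lemma interp_eq_weight:
  assumes "0 < t" "t < 1"
  shows "interp F G t x = weight x * exp (t * logr x)"
proof (cases "F x = 0 \<or> G x = 0")
  case True
  then show ?thesis using assms by (auto simp: interp_def weight_def)
next
  case False
  then have pos: "0 < F x" "0 < G x" using F_nonneg[of x] G_nonneg[of x] by auto
  have "interp F G t x = exp (ln (F x) + t * logr x)"
    unfolding interp_pos[of F x G, OF pos] logr_def by (simp add: algebra_simps)
  then show ?thesis using pos by (simp add: exp_add weight_def)
qed

text \<open>The total mass is at most \<open>Z F G 0\<close>, the integral of
  \<open>exp (logr x)\<close> is at most \<open>Z F G 1\<close>, and \<open>overlap\<close> excludes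
  the null measure.\<close>

lemma exp_family_base: "exp_family base logr"
proof -
  have "emeasure base (space base) = (\<integral>\<^sup>+x. ennreal (weight x) \<partial>lebesgue)"
    by (simp add: base_def emeasure_density)
  also have "\<dots> \<le> Z F G 0"
    unfolding Z_def by (intro nn_integral_mono) (simp add: interp_def weight_le ennreal_leI)
  finally have fin: "emeasure base (space base) \<noteq> \<infinity>" using Z_0_finite by auto
  have "(\<integral>\<^sup>+x. ennreal (exp (logr x)) \<partial>base) = (\<integral>\<^sup>+x. ennreal (weight x * exp (logr x)) \<partial>lebesgue)"
    by (simp add: base_def nn_integral_density weight_nonneg flip: ennreal_mult)
  also have "\<dots> \<le> Z F G 1"
    unfolding Z_def by (intro nn_integral_mono) (simp add: interp_def weight_exp_le ennreal_leI)
  finally have int: "integrable base (\<lambda>x. exp (logr x))"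
    using Z_1_finite by (intro integrableI_nonneg) (auto simp: base_def)
  have "emeasure base (space base) \<noteq> 0"
  proof
    assume "emeasure base (space base) = 0"
    then have "AE x in lebesgue. weight x = 0"
      using weight_nonneg
      by (simp add: base_def emeasure_density nn_integral_0_iff_AE ennreal_eq_0_iff order_antisym_conv)
    then have "AE x in lebesgue. ennreal (interp F G (1 / 2) x) = 0"
      by eventually_elim (simp add: interp_eq_weight)
    then have "Z F G (1 / 2) = 0"
      unfolding Z_def by (subst nn_integral_0_iff_AE) auto
    then show False using overlap by simp
  qed
  with fin int show ?thesis
    by (intro exp_family.intro finite_measureI exp_family_axioms.intro) (simp_all add: base_def)
qed

sublocale exp_family base logr
  by (rule exp_family_base)

text \<open>The hypothesis \<open>ae\<close> always holds for \<open>0 < t\<close>. At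
  \<open>t = 0\<close> it says that \<open>G\<close> is nonzero almost everywhere where
  \<open>F\<close> is, so stating it this way includes the well-behaved end point.\<close>

lemma Z_eq_moment:
  assumes t: "0 \<le> t" "t < 1" and ae: "AE x in lebesgue. interp F G t x = weight x * exp (t * logr x)"
  shows "Z F G t = ennreal (moment 0 t)"
proof -
  have "Z F G t = (\<integral>\<^sup>+x. ennreal (weight x * exp (t * logr x)) \<partial>lebesgue)"
    unfolding Z_def using ae by (intro nn_integral_cong_AE) auto
  also have "\<dots> = (\<integral>\<^sup>+x. ennreal (exp (t * logr x)) \<partial>base)"
    by (simp add: base_def nn_integral_density weight_nonneg flip: ennreal_mult)
  also have "\<dots> = ennreal (moment 0 t)"
    unfolding moment_def using integrable_moment_right[of 0 t] t
    by (subst nn_integral_eq_integral) auto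
  finally show ?thesis .
qed

lemma mu_eq_tilt:
  assumes t: "0 \<le> t" "t < 1" and ae: "AE x in lebesgue. interp F G t x = weight x * exp (t * logr x)"
  shows "mu F G t = tilt t"
proof -
  have "tilt t = density lebesgue (\<lambda>x. ennreal (weight x) * ennreal (exp (t * logr x) / moment 0 t))"
    unfolding tilt_def
    using density_density_eq[of "\<lambda>x. ennreal (weight x)" lebesgue
        "\<lambda>x. ennreal (exp (t * logr x) / moment 0 t)", folded base_def] by simp
  also have "\<dots> = mu F G t"
    unfolding mu_def
  proof (rule density_cong)
    show "AE x in lebesgue. ennreal (weight x) * ennreal (exp (t * logr x) / moment 0 t)
        = ennreal (interp F G t x) / Z F G t"
      using ae
      by eventually_elim (use moment_0_pos[OF t] weight_nonneg in
        \<open>simp add: Z_eq_moment[OF assms] divide_ennreal flip: ennreal_mult\<close>)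
  qed simp_all
  finally show ?thesis by simp
qed

lemma ext_variance_mu:
  assumes t: "0 \<le> t" "t < 1" and ae: "AE x in lebesgue. interp F G t x = weight x * exp (t * logr x)"
  shows "ext_variance (mu F G t) (log_ratio F G) = ext_variance (tilt t) (\<lambda>x. ereal (logr x))"
  unfolding mu_eq_tilt[OF assms]
proof (rule ext_variance_cong_AE)
  have "AE x in base. log_ratio F G x = ereal (logr x)"
    unfolding base_def
  proof (subst AE_density)
    show "AE x in lebesgue. 0 < ennreal (weight x) \<longrightarrow> log_ratio F G x = ereal (logr x)"
    proof (intro AE_I2 impI)
      fix x assume "0 < ennreal (weight x)"
      then have "0 < F x" "0 < G x"
        using F_nonneg[of x] G_nonneg[of x] by (auto simp: weight_def less_le split: if_splits)
      then show "log_ratio F G x = ereal (logr x)"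
        by (simp add: log_ratio_def elog_ereal logr_def)
    qed
  qed simp
  then show "AE x in tilt t. log_ratio F G x = ereal (logr x)"
    unfolding tilt_def by (subst AE_density) auto
qed (simp_all add: tilt_def)

section \<open>Derivatives of \<open>log Z\<close> in the interior and at 0\<close>

definition lnZ :: "real \<Rightarrow> real" where
  "lnZ t = ln (enn2real (Z F G t))"

lemma lnZ_eq_cumulant:
  assumes "0 < t" "t < 1"
  shows "lnZ t = cumulant t"
  using Z_eq_moment[of t] moment_0_pos[of t] assms
  by (simp add: lnZ_def cumulant_def interp_eq_weight)

lemma elog_Z:
  assumes "0 < t" "t < 1"
  shows "elog (Z F G t) = ereal (cumulant t)"
  using Z_eq_moment[of t] moment_0_pos[of t] assms
  by (simp add: cumulant_def interp_eq_weight elog_ereal)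

lemma lnZ_DERIV:
  assumes "0 < t" "t < 1"
  shows "(lnZ has_real_derivative mean t) (at t)"
  by (rule DERIV_cong_ev[THEN iffD2, OF refl _ refl cumulant_DERIV[OF assms]])
    (use eventually_nhds_in_open[of "{0<..<1}" t] assms
      in \<open>auto elim!: eventually_mono simp: lnZ_eq_cumulant\<close>)

text \<open>Quantifying over every \<open>\<psi>\<close> that agrees with the first derivative on
  \<open>[0, 1)\<close> leaves its value at 1 free, so that one function can later serve both end
  points.\<close>

lemma ext_derivatives_at_0:
  "\<exists>D. has_ext_derivative (\<lambda>t. elog (Z F G t)) D 0 {0..1} \<and>
    (\<forall>\<psi>. \<psi> 0 = D \<longrightarrow> (\<forall>t. 0 < t \<longrightarrow> t < 1 \<longrightarrow> \<psi> t = ereal (mean t)) \<longrightarrow>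
      has_ext_derivative \<psi> (ext_variance (mu F G 0) (log_ratio F G)) 0 {0..1})"
proof -
  \<comment> \<open>If \<open>\<psi> 0\<close> is \<open>- \<infinity>\<close> and
    \<open>\<psi>\<close> is finite to its right, every quotient
    \<open>(\<psi> s - \<psi> 0) / s\<close> with \<open>0 < s < 1\<close> is already
    \<infinity>.\<close>
  have infinite_case: ?thesis
    if "has_ext_derivative (\<lambda>t. elog (Z F G t)) (- \<infinity>) 0 {0..1}"
      and "ext_variance (mu F G 0) (log_ratio F G) = \<infinity>"
  proof (intro exI conjI allI impI)
    fix \<psi> assume "\<psi> 0 = - \<infinity>" "\<forall>t. 0 < t \<longrightarrow> t < 1 \<longrightarrow> \<psi> t = ereal (mean t)"
    then show "has_ext_derivative \<psi> (ext_variance (mu F G 0) (log_ratio F G)) 0 {0..1}"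
      using that(2) by (intro has_ext_derivative_at_0I[where Q = "\<lambda>_. \<infinity>"]) auto
  qed (rule that)
  show ?thesis
  proof (cases "AE x in lebesgue. F x \<noteq> 0 \<longrightarrow> G x \<noteq> 0")
    case True
    then have ae: "AE x in lebesgue. interp F G 0 x = weight x * exp (0 * logr x)"
      by eventually_elim (auto simp: interp_def weight_def)
    have Z0: "elog (Z F G 0) = ereal (cumulant 0)"
      using moment_0_pos[of 0] by (simp add: Z_eq_moment[OF _ _ ae] elog_ereal cumulant_def)
    have var0: "ext_variance (mu F G 0) (log_ratio F G) = ext_variance (tilt 0) (\<lambda>x. ereal (logr x))"
      by (rule ext_variance_mu[OF _ _ ae]) auto
    have first: "has_ext_derivative (\<lambda>t. elog (Z F G t)) D 0 {0..1}"
      if "((\<lambda>t. ereal (mean t)) \<longlongrightarrow> D) (at_right 0)" for D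
      by (rule has_ext_derivative_at_0I[OF _ quotient_tendsto[OF cumulant_tendsto cumulant_DERIV that]])
        (auto simp: elog_Z Z0)
    show ?thesis
    proof (cases "integrable base logr")
      case int: True
      show ?thesis
      proof (intro exI conjI allI impI)
        show "has_ext_derivative (\<lambda>t. elog (Z F G t)) (ereal (mean 0)) 0 {0..1}"
          by (intro first tendsto_ereal mean_tendsto int)
        fix \<psi> assume "\<psi> 0 = ereal (mean 0)" "\<forall>t. 0 < t \<longrightarrow> t < 1 \<longrightarrow> \<psi> t = ereal (mean t)"
        then show "has_ext_derivative \<psi> (ext_variance (mu F G 0) (log_ratio F G)) 0 {0..1}"
          unfolding var0
          by (intro has_ext_derivative_at_0I[OF _ quotient_tendsto[OF mean_tendsto[OF int] mean_DERIV var_tendsto[OF int]]])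
            auto
      qed
    next
      case False
      \<comment> \<open>On a finite measure square integrability implies integrability, so the
        variance is infinite as well.\<close>
      have "\<not> integrable base (\<lambda>x. (logr x)\<^sup>2)"
      proof
        assume "integrable base (\<lambda>x. (logr x)\<^sup>2)"
        from square_integrable_imp_integrable[OF L this] False show False by contradiction
      qed
      then have "ext_variance (mu F G 0) (log_ratio F G) = \<infinity>"
        by (simp add: var0 ext_variance_tilt)
      with first[OF mean_tendsto_MInfty[OF False]] show ?thesis by (rule infinite_case)
    qed
  next
    case False
    \<comment> \<open>The number \<open>moment 0 0\<close> is the right limit of \<open>Z\<close> at
      0. It misses the mass of \<open>F\<close> on the zeros of \<open>G\<close>, hence is strictly
      less than \<open>Z F G 0\<close>.\<close>
    have "ennreal (moment 0 0) = (\<integral>\<^sup>+x. ennreal (weight x) \<partial>lebesgue)"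
      using finite_emeasure_space
      by (simp add: moment_def emeasure_eq_measure[symmetric]) (simp add: base_def emeasure_density)
    also have "\<dots> < Z F G 0"
      unfolding Z_def
    proof (rule nn_integral_less)
      show "\<not> (AE x in lebesgue. ennreal (interp F G 0 x) \<le> ennreal (weight x))"
      proof
        assume "AE x in lebesgue. ennreal (interp F G 0 x) \<le> ennreal (weight x)"
        then have "AE x in lebesgue. F x \<noteq> 0 \<longrightarrow> G x \<noteq> 0"
          by eventually_elim (use F_nonneg in \<open>auto simp: interp_def weight_def order_antisym_conv split: if_splits\<close>)
        with False show False ..
      qed
      have "(\<integral>\<^sup>+x. ennreal (weight x) \<partial>lebesgue) \<le> Z F G 0"
        unfolding Z_def by (intro nn_integral_mono) (simp add: interp_def weight_le ennreal_leI)
      then show "(\<integral>\<^sup>+x. ennreal (weight x) \<partial>lebesgue) \<noteq> \<infinity>" using Z_0_finite by auto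
    qed (auto simp: interp_def weight_le ennreal_leI)
    finally have less: "ennreal (moment 0 0) < Z F G 0" .
    obtain z where z: "Z F G 0 = ennreal z" "0 \<le> z"
      using Z_0_finite by (cases "Z F G 0" rule: ennreal_cases) auto
    with less have mz: "moment 0 0 < z" using moment_0_pos[of 0] by (simp add: ennreal_less_iff)
    then have "0 < z" using moment_0_pos[of 0] by linarith
    then have Z0: "elog (Z F G 0) = ereal (ln z)" by (simp add: z elog_ereal)
    have "0 < ln z - cumulant 0"
      using mz moment_0_pos[of 0] by (simp add: cumulant_def)
    moreover have "((\<lambda>s. ln z - cumulant s) \<longlongrightarrow> ln z - cumulant 0) (at_right 0)"
      by (intro tendsto_intros cumulant_tendsto)
    \<comment> \<open>The jump has a positive limit, so its quotient by \<open>s\<close>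
      diverges.\<close>
    ultimately have "filterlim (\<lambda>s. (ln z - cumulant s) * inverse s) at_top (at_right 0)"
      using filterlim_tendsto_pos_mult_at_top filterlim_inverse_at_top_right by blast
    then have "((\<lambda>s. - ereal ((ln z - cumulant s) * inverse s)) \<longlongrightarrow> - \<infinity>) (at_right 0)"
      unfolding tendsto_PInfty_eq_at_top[symmetric] by (rule tendsto_uminus_ereal)
    then have "has_ext_derivative (\<lambda>t. elog (Z F G t)) (- \<infinity>) 0 {0..1}"
      by (rule has_ext_derivative_at_0I[rotated]) (auto simp: elog_Z Z0 field_simps)
    \<comment> \<open>A finite second moment would make \<open>log_ratio F G\<close> finite almost
      everywhere under \<open>mu F G 0\<close>, but it is \<open>- \<infinity>\<close> where
      \<open>F > 0 = G\<close>, a set of positive mass.\<close>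
    moreover have "(\<integral>\<^sup>+x. e2ennreal ((log_ratio F G x)\<^sup>2) \<partial>mu F G 0) = \<infinity>"
    proof (rule ccontr)
      assume "(\<integral>\<^sup>+x. e2ennreal ((log_ratio F G x)\<^sup>2) \<partial>mu F G 0) \<noteq> \<infinity>"
      then have "AE x in mu F G 0. e2ennreal ((log_ratio F G x)\<^sup>2) \<noteq> \<infinity>"
        by (intro nn_integral_PInf_AE) (simp_all add: mu_def power2_eq_square)
      then have "AE x in lebesgue. 0 < ennreal (interp F G 0 x) / Z F G 0
          \<longrightarrow> e2ennreal ((log_ratio F G x)\<^sup>2) \<noteq> \<infinity>"
        unfolding mu_def by (subst (asm) AE_density) auto
      then have "AE x in lebesgue. F x \<noteq> 0 \<longrightarrow> G x \<noteq> 0"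
      proof eventually_elim
        case (elim x)
        show ?case
        proof (intro impI notI)
          assume "F x \<noteq> 0" "G x = 0"
          then have "0 < F x" using F_nonneg[of x] by simp
          then have "log_ratio F G x = - \<infinity>" "0 < ennreal (interp F G 0 x) / Z F G 0"
            using \<open>G x = 0\<close> \<open>0 < z\<close>
            by (auto simp: log_ratio_def elog_def interp_def z divide_ennreal)
          then show False using elim by (simp add: power2_eq_square)
        qed
      qed
      with False show False ..
    qed
    then have "ext_variance (mu F G 0) (log_ratio F G) = \<infinity>"
      by (simp add: ext_variance_def)
    ultimately show ?thesis by (rule infinite_case)
  qed
qed

section \<open>Exchanging \<open>F\<close> and \<open>G\<close>, and joining the two end points to
  the interior\<close>

lemma swap: "overlapping_pair G F"
proof
  show "Z G F 0 < \<infinity>" "Z G F 1 < \<infinity>" "0 < Z G F (1 / 2)"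
    using Z_swap[of F G 0] Z_swap[of F G 1] Z_swap[of F G "1 / 2"] Z_0_finite Z_1_finite overlap
    by simp_all
qed (simp_all add: F_nonneg G_nonneg)

text \<open>Both sides are derivatives of the same function \<open>lnZ\<close>, one through the
  reflected pair and the chain rule, so uniqueness of derivatives identifies them without comparing
  integrals.\<close>

lemma mean_swap:
  assumes "0 < t" "t < 1"
  shows "exp_family.mean (overlapping_pair.base G F) (overlapping_pair.logr G F) (1 - t) = - mean t"
proof -
  interpret GF: overlapping_pair G F by (rule swap)
  have "((\<lambda>s. GF.lnZ (1 - s)) has_real_derivative GF.mean (1 - t) * - 1) (at t)"
    using assms by (intro DERIV_chain2[OF GF.lnZ_DERIV]) (auto intro!: derivative_eq_intros)
  moreover have "(\<lambda>s. GF.lnZ (1 - s)) = lnZ"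
    by (simp add: lnZ_def[abs_def] GF.lnZ_def Z_swap)
  ultimately show ?thesis
    using DERIV_unique[OF lnZ_DERIV[OF assms]] by fastforce
qed

lemma ext_derivatives:
  "\<exists>\<psi>. \<forall>\<theta>\<in>{0..1}.
     has_ext_derivative (\<lambda>t. elog (Z F G t)) (\<psi> \<theta>) \<theta> {0..1} \<and>
     has_ext_derivative \<psi> (ext_variance (mu F G \<theta>) (log_ratio F G)) \<theta> {0..1}"
proof -
  interpret GF: overlapping_pair G F by (rule swap)
  obtain D0 where D0: "has_ext_derivative (\<lambda>t. elog (Z F G t)) D0 0 {0..1}"
    "\<And>\<psi>. \<psi> 0 = D0 \<Longrightarrow> (\<And>t. 0 < t \<Longrightarrow> t < 1 \<Longrightarrow> \<psi> t = ereal (mean t)) \<Longrightarrow>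
      has_ext_derivative \<psi> (ext_variance (mu F G 0) (log_ratio F G)) 0 {0..1}"
    using ext_derivatives_at_0 by blast
  obtain D1 where D1: "has_ext_derivative (\<lambda>t. elog (Z G F t)) D1 0 {0..1}"
    "\<And>\<psi>. \<psi> 0 = D1 \<Longrightarrow> (\<And>t. 0 < t \<Longrightarrow> t < 1 \<Longrightarrow> \<psi> t = ereal (GF.mean t)) \<Longrightarrow>
      has_ext_derivative \<psi> (ext_variance (mu G F 0) (log_ratio G F)) 0 {0..1}"
    using GF.ext_derivatives_at_0 by blast
  \<comment> \<open>The value at 1 is \<open>- D1\<close> because the reflection
    \<open>t \<mapsto> 1 - t\<close> reverses the sign of a first derivative.\<close>
  define \<psi> where "\<psi> t = (if t = 0 then D0 else if t = 1 then - D1 else ereal (mean t))" for t :: real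
  have \<psi>: "\<psi> t = ereal (mean t)" if "0 < t" "t < 1" for t
    using that by (simp add: \<psi>_def)
  have "has_ext_derivative (\<lambda>t. elog (Z F G t)) (\<psi> \<theta>) \<theta> {0..1} \<and>
      has_ext_derivative \<psi> (ext_variance (mu F G \<theta>) (log_ratio F G)) \<theta> {0..1}"
    if "\<theta> \<in> {0..1}" for \<theta>
  proof -
    have "\<theta> \<noteq> 0 \<Longrightarrow> 0 < \<theta>" "\<theta> \<noteq> 1 \<Longrightarrow> \<theta> < 1" using that by auto
    then consider "\<theta> = 0" | "\<theta> = 1" | "0 < \<theta>" "\<theta> < 1" by blast
    then show ?thesis
    proof cases
      case 1
      then show ?thesis using D0(1) D0(2)[of \<psi>] \<psi> by (simp add: \<psi>_def)
    next
      case 2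
      have "has_ext_derivative (\<lambda>t. elog (Z F G t)) (- D1) 1 {0..1}"
        using D1(1) Z_swap[of F G] by (intro has_ext_derivative_reflect) simp
      moreover have "has_ext_derivative \<psi> (ext_variance (mu F G 1) (log_ratio F G)) 1 {0..1}"
      proof -
        \<comment> \<open>The first derivative for the exchanged pair is
          \<open>- \<psi> (1 - t)\<close>, with value \<open>D1\<close> at 0. Reflecting gives the
          negated variance for \<open>- \<psi>\<close>, and a further negation removes both
          signs.\<close>
        have "has_ext_derivative (\<lambda>t. - \<psi> (1 - t)) (ext_variance (mu G F 0) (log_ratio G F)) 0 {0..1}"
        proof (rule D1(2))
          fix t :: real assume "0 < t" "t < 1"
          then show "- \<psi> (1 - t) = ereal (GF.mean t)"
            using mean_swap[of "1 - t"] by (simp add: \<psi>)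
        qed (simp add: \<psi>_def)
        then have "has_ext_derivative (\<lambda>t. - \<psi> t) (- ext_variance (mu F G 1) (log_ratio F G)) 1 {0..1}"
          using mu_swap[of G F 1] ext_variance_log_ratio_swap[of _ G F]
          by (intro has_ext_derivative_reflect) simp
        then have "has_ext_derivative (\<lambda>t. - (- \<psi> t)) (- (- ext_variance (mu F G 1) (log_ratio F G))) 1 {0..1}"
        proof (rule has_ext_derivative_uminus)
          have "\<forall>\<^sub>F s in at_left 1. 0 < s \<and> s < (1::real)"
            by (auto simp: eventually_at_left_field intro!: exI[of _ 0])
          then show "\<forall>\<^sub>F s in at 1 within {0..1}. \<bar>- \<psi> s\<bar> \<noteq> \<infinity>"
            by (auto simp: at_within_Icc_at_left \<psi> elim!: eventually_mono)
        qed
        then show ?thesis by simp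
      qed
      ultimately show ?thesis using 2 by (simp add: \<psi>_def)
    next
      case 3
      have "ext_variance (mu F G \<theta>) (log_ratio F G) = ereal (var \<theta>)"
        using 3 integrable_moment[of \<theta> 2]
        by (simp add: ext_variance_mu interp_eq_weight ext_variance_tilt)
      then show ?thesis
        using 3 has_ext_derivative_interiorI[OF elog_Z cumulant_DERIV, of \<theta>]
          has_ext_derivative_interiorI[OF \<psi> mean_DERIV, of \<theta>] by (simp add: \<psi>)
    qed
  qed
  then show ?thesis by blast
qed

text \<open>In the interior all moments are finite, so the formula holds with ordinary derivatives
  and integrals, \<open>mean\<close> being the first derivative.\<close>

lemma real_derivatives:
  assumes \<theta>: "0 < \<theta>" "\<theta> < 1"
  shows "((\<lambda>t. ln (enn2real (Z F G t))) has_real_derivative mean \<theta>) (at \<theta>) \<and>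
     integrable (mu F G \<theta>) (\<lambda>x. (ln (G x) - ln (F x))\<^sup>2) \<and>
     (mean has_real_derivative
        (\<integral>x. (ln (G x) - ln (F x))\<^sup>2 \<partial>mu F G \<theta>) - (\<integral>x. ln (G x) - ln (F x) \<partial>mu F G \<theta>)\<^sup>2) (at \<theta>)"
proof -
  have mu: "mu F G \<theta> = tilt \<theta>"
    using \<theta> by (intro mu_eq_tilt) (auto simp: interp_eq_weight)
  have "integrable (tilt \<theta>) (\<lambda>x. (logr x)\<^sup>2)"
    using \<theta> integrable_moment[of \<theta> 2] by (simp add: integrable_tilt)
  moreover have "(\<integral>x. (logr x)\<^sup>2 \<partial>tilt \<theta>) - (\<integral>x. logr x \<partial>tilt \<theta>)\<^sup>2 = var \<theta>"
    using \<theta> by (simp add: integral_tilt var_def mean_def moment_def)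
  ultimately show ?thesis
    using lnZ_DERIV[OF \<theta>] mean_DERIV[OF \<theta>] by (simp add: mu lnZ_def[abs_def] logr_def[abs_def])
qed

end

theorem corollary4p4:
  fixes p q :: real and f g F G :: "real ^ 'n \<Rightarrow> real"
  assumes "1 < p" and "1 < q" and "1 / p + 1 / q = 1"
    and "f \<in> borel_measurable lebesgue" and "g \<in> borel_measurable lebesgue"
    and "\<And>x. 0 \<le> f x" and "\<And>x. 0 \<le> g x"
    and "0 < (\<integral>\<^sup>+x. ennreal (f x powr p) \<partial>lebesgue)"
    and "(\<integral>\<^sup>+x. ennreal (f x powr p) \<partial>lebesgue) < \<infinity>"
    and "0 < (\<integral>\<^sup>+x. ennreal (g x powr q) \<partial>lebesgue)"
    and "(\<integral>\<^sup>+x. ennreal (g x powr q) \<partial>lebesgue) < \<infinity>"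
    and "F = (\<lambda>x. f x powr p)" and "G = (\<lambda>x. g x powr q)"
  shows
    "ext_convex_on {0..1} (\<lambda>\<theta>. elog (Z F G \<theta>)) \<and>
     ((\<forall>\<theta>\<in>{0..1}. 0 < Z F G \<theta>) \<longrightarrow>
        (\<exists>\<psi>. \<forall>\<theta>\<in>{0..1}.
           has_ext_derivative (\<lambda>t. elog (Z F G t)) (\<psi> \<theta>) \<theta> {0..1} \<and>
           has_ext_derivative \<psi> (ext_variance (mu F G \<theta>) (log_ratio F G)) \<theta> {0..1}) \<and>
        (\<exists>\<psi>. \<forall>\<theta>\<in>{0<..<1}.
           ((\<lambda>t. ln (enn2real (Z F G t))) has_real_derivative \<psi> \<theta>) (at \<theta>) \<and>
           integrable (mu F G \<theta>) (\<lambda>x. (ln (G x) - ln (F x))\<^sup>2) \<and>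
           (\<psi> has_real_derivative
              (\<integral>x. (ln (G x) - ln (F x))\<^sup>2 \<partial>mu F G \<theta>)
              - (\<integral>x. ln (G x) - ln (F x) \<partial>mu F G \<theta>)\<^sup>2) (at \<theta>)))"
proof (intro conjI impI)
  have FG [measurable]: "F \<in> borel_measurable lebesgue" "G \<in> borel_measurable lebesgue"
    using assms(4,5) unfolding assms(12,13) by measurable
  have nonneg: "0 \<le> F x" "0 \<le> G x" for x
    by (simp_all add: assms(12,13))
  have fin: "Z F G 0 < \<infinity>" "Z F G 1 < \<infinity>"
    using assms(9,11) by (simp_all add: Z_def interp_def assms(12,13))
  show "ext_convex_on {0..1} (\<lambda>\<theta>. elog (Z F G \<theta>))"
    by (rule Z_log_convex[OF FG nonneg fin])
  assume pos: "\<forall>\<theta>\<in>{0..1}. 0 < Z F G \<theta>"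
  interpret overlapping_pair F G
    using FG nonneg fin pos by unfold_locales auto
  show "\<exists>\<psi>. \<forall>\<theta>\<in>{0..1}.
      has_ext_derivative (\<lambda>t. elog (Z F G t)) (\<psi> \<theta>) \<theta> {0..1} \<and>
      has_ext_derivative \<psi> (ext_variance (mu F G \<theta>) (log_ratio F G)) \<theta> {0..1}"
    by (rule ext_derivatives)
  show "\<exists>\<psi>. \<forall>\<theta>\<in>{0<..<1}.
      ((\<lambda>t. ln (enn2real (Z F G t))) has_real_derivative \<psi> \<theta>) (at \<theta>) \<and>
      integrable (mu F G \<theta>) (\<lambda>x. (ln (G x) - ln (F x))\<^sup>2) \<and>
      (\<psi> has_real_derivative
         (\<integral>x. (ln (G x) - ln (F x))\<^sup>2 \<partial>mu F G \<theta>)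
         - (\<integral>x. ln (G x) - ln (F x) \<partial>mu F G \<theta>)\<^sup>2) (at \<theta>)"
    by (intro exI[of _ mean] ballI real_derivatives) auto
qed

end
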